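(* Let $k\ge 2$, let $\gamma,\delta\in\mathcal P_k$ and let $\mathcal M=\Phi(\gamma,\delta)$ be the corresponding tame $SL_k$-tiling. Then its dual satisfies $\mathcal M^*=\Phi(A\widetilde\gamma,\widetilde\delta)$ for some $A\in SL_k(\mathbb Z)$.
   Context: A path is a bi-infinite sequence $\gamma=(\gamma_i)_{i\in\mathbb Z}$ of column vectors $\gamma_i\in\mathbb Z^k$ such that every matrix $(\gamma_i,\ldots,\gamma_{i+k-1})$ lies in $SL_k(\mathbb Z)$; $\mathcal P_k$ is the set of paths. For $A\in SL_k(\mathbb Z)$, $A\gamma=(A\gamma_i)_{i\in\mathbb Z}$. For $\gamma,\delta\in\mathcal P_k$, $\Phi(\gamma,\delta)$ is the array $(m_{i\,j})_{i,j\in\mathbb Z}$ with $m_{i\,j}=\det(\gamma_i,\ldots,\gamma_{i+k-2},\delta_j)$; it is a tame $SL_k$-tiling (integer array with all adjacent $k\times k$ minors $1$ and all adjacent $(k+1)\times(k+1)$ minors $0$). The dual $\mathcal M^*$ of a tiling $\mathcal M=(m_{i\,j})$ is the array whose $(i,j)$ entry is the adjacent $(k-1)\times(k-1)$ minor of $\mathcal M$ with upper-left entry $m_{i\,j}$, i.e. on rows $i,\ldots,i+k-2$ and columns $j,\ldots,j+k-2$. The $J$ matrices of a path $\gamma$: for each $i\in\mathbb Z$ there are unique integers $j_{i\,1}=(-1)^{k-1},j_{i\,2},\ldots,j_{i\,k}$ with $\gamma_{i+k}=\sum_{q=1}^{k}j_{i\,q}\gamma_{i+q-1}$; $J_i\in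 SL_k(\mathbb Z)$ is the matrix with $(\gamma_i,\ldots,\gamma_{i+k-1})J_i=(\gamma_{i+1},\ldots,\gamma_{i+k})$, whose last column is $(j_{i\,1},\ldots,j_{i\,k})^T$ and whose first $k-1$ columns are the standard basis vectors $e_2,\ldots,e_k$. The path $\widetilde\gamma\in\mathcal P_k$ is defined by $(\widetilde\gamma_1,\ldots,\widetilde\gamma_k)=(\gamma_1,\ldots,\gamma_k)^T$ (matrix transpose) and by its $J$ matrices $\widetilde{J_i}$, whose last column has entries $\widetilde{j_{i\,1}}=(-1)^{k-1}$ and $\widetilde{j_{i\,q}}=(-1)^k j_{i+q-2,\;k-q+2}$ for $2\le q\le k$, $i\in\mathbb Z$. *)

theory Defs
  imports "Jordan_Normal_Form.Determinant"
begin

definition SL :: "nat \<Rightarrow> int mat set" where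
  "SL k = {A \<in> carrier_mat k k. det A = 1}"

text \<open>The matrix with columns \<open>\<gamma> i, \<dots>, \<gamma> (i + k - 1)\<close>.\<close>

definition window :: "nat \<Rightarrow> (int \<Rightarrow> int vec) \<Rightarrow> int \<Rightarrow> int mat" where
  "window k \<gamma> i = mat_of_cols k (map (\<lambda>q. \<gamma> (i + int q)) [0..<k])"

definition paths :: "nat \<Rightarrow> (int \<Rightarrow> int vec) set" where
  "paths k = {\<gamma>. (\<forall>i. \<gamma> i \<in> carrier_vec k) \<and> (\<forall>i. window k \<gamma> i \<in> SL k)}"

definition mat_act :: "int mat \<Rightarrow> (int \<Rightarrow> int vec) \<Rightarrow> (int \<Rightarrow> int vec)" where
  "mat_act A \<gamma> = (\<lambda>i. A *\<^sub>v \<gamma> i)"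

text \<open>Entry \<open>(i, j)\<close> is \<open>det (\<gamma> i, \<dots>, \<gamma> (i + k - 2), \<delta> j)\<close>.\<close>

definition Phi :: "nat \<Rightarrow> (int \<Rightarrow> int vec) \<Rightarrow> (int \<Rightarrow> int vec) \<Rightarrow> int \<Rightarrow> int \<Rightarrow> int" where
  "Phi k \<gamma> \<delta> i j =
     det (mat_of_cols k (map (\<lambda>q. \<gamma> (i + int q)) [0..<k - 1] @ [\<delta> j]))"

definition adjacent_minor :: "nat \<Rightarrow> (int \<Rightarrow> int \<Rightarrow> int) \<Rightarrow> int \<Rightarrow> int \<Rightarrow> int" where
  "adjacent_minor r M i j = det (mat r r (\<lambda>(a, b). M (i + int a) (j + int b)))"

definition tiling_dual :: "nat \<Rightarrow> (int \<Rightarrow> int \<Rightarrow> int) \<Rightarrow> int \<Rightarrow> int \<Rightarrow> int" where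
  "tiling_dual k M = adjacent_minor (k - 1) M"

text \<open>The coefficients \<open>j\<^bsub>i q\<^esub>\<close>, where \<open>q\<close> runs over \<open>1, \<dots>, k\<close> (whereas entries of vectors and
  matrices are indexed from \<open>0\<close>): the unique integers with
  \<open>\<gamma> (i + k) = (\<Sum>q = 1..k. j\<^bsub>i q\<^esub> \<cdot> \<gamma> (i + q - 1))\<close>. See \<open>j_coeff_ex1\<close> below.\<close>

definition j_coeff :: "nat \<Rightarrow> (int \<Rightarrow> int vec) \<Rightarrow> int \<Rightarrow> nat \<Rightarrow> int" where
  "j_coeff k \<gamma> i q =
     (THE c. c \<in> carrier_vec k \<and> \<gamma> (i + int k) = window k \<gamma> i *\<^sub>v c) $ (q - 1)"

text \<open>Last column \<open>(c 1, \<dots>, c k)\<close>, first \<open>k - 1\<close> columns \<open>e\<^sub>2, \<dots>, e\<^sub>k\<close>.\<close>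

definition shift_mat :: "nat \<Rightarrow> (nat \<Rightarrow> int) \<Rightarrow> int mat" where
  "shift_mat k c = mat k k (\<lambda>(r, s). if s = k - 1 then c (r + 1) else if r = s + 1 then 1 else 0)"

definition J_mat :: "nat \<Rightarrow> (int \<Rightarrow> int vec) \<Rightarrow> int \<Rightarrow> int mat" where
  "J_mat k \<gamma> i = shift_mat k (j_coeff k \<gamma> i)"

definition tilde_coeff :: "nat \<Rightarrow> (int \<Rightarrow> int vec) \<Rightarrow> int \<Rightarrow> nat \<Rightarrow> int" where
  "tilde_coeff k \<gamma> i q =
     (if q = 1 then (- 1) ^ (k - 1)
      else (- 1) ^ k * j_coeff k \<gamma> (i + int q - 2) (k - q + 2))"

text \<open>The unique path with prescribed initial window and \<open>J\<close> matrices; see \<open>tilde_path_ex1\<close> below.\<close>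

definition tilde_path :: "nat \<Rightarrow> (int \<Rightarrow> int vec) \<Rightarrow> (int \<Rightarrow> int vec)" where
  "tilde_path k \<gamma> =
     (THE \<eta>. \<eta> \<in> paths k \<and> window k \<eta> 1 = transpose_mat (window k \<gamma> 1)
           \<and> (\<forall>i. J_mat k \<eta> i = shift_mat k (tilde_coeff k \<gamma> i)))"

lemma window_carrier [simp]: "window k \<gamma> i \<in> carrier_mat k k"
  unfolding window_def by (metis length_map length_upt minus_nat.diff_0 mat_of_cols_carrier(1))

lemma window_dim [simp]: "dim_row (window k \<gamma> i) = k" "dim_col (window k \<gamma> i) = k"
  by (rule carrier_matD[OF window_carrier])+

lemma shift_mat_carrier [simp]: "shift_mat k c \<in> carrier_mat k k"
  unfolding shift_mat_def by simp

lemma window_index: "r < k \<Longrightarrow> s < k \<Longrightarrow> window k \<gamma> i $$ (r, s) = \<gamma> (i + int s) $ r"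
  unfolding window_def by (subst mat_of_cols_index) auto

lemma SL_D: "A \<in> SL k \<Longrightarrow> A \<in> carrier_mat k k" "A \<in> SL k \<Longrightarrow> det A = 1"
  unfolding SL_def by auto

lemma SL_mult: "A \<in> SL k \<Longrightarrow> B \<in> SL k \<Longrightarrow> A * B \<in> SL k"
  unfolding SL_def by (auto simp: det_mult)

lemma SL_inverse:
  assumes "A \<in> SL k"
  obtains B where "B \<in> SL k" "A * B = 1\<^sub>m k" "B * A = 1\<^sub>m k"
proof -
  have A: "A \<in> carrier_mat k k" and d: "det A = 1" using assms by (auto simp: SL_def)
  note adj = adj_mat[OF A]
  have id: "(1::int) \<cdot>\<^sub>m 1\<^sub>m k = 1\<^sub>m k" by (intro eq_matI) auto
  have e: "A * adj_mat A = 1\<^sub>m k" "adj_mat A * A = 1\<^sub>m k" using adj d id by auto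
  have "det A * det (adj_mat A) = 1"
    using det_mult[OF A adj(1)] e by simp
  then have "adj_mat A \<in> SL k" using adj(1) d by (auto simp: SL_def)
  then show ?thesis using e that by blast
qed

lemma j_coeff_ex1:
  assumes "\<gamma> \<in> paths k"
  shows "\<exists>!c. c \<in> carrier_vec k \<and> \<gamma> (i + int k) = window k \<gamma> i *\<^sub>v c"
proof -
  have W: "window k \<gamma> i \<in> SL k" and g: "\<gamma> (i + int k) \<in> carrier_vec k"
    using assms by (auto simp: paths_def)
  obtain B where B: "B \<in> SL k" "window k \<gamma> i * B = 1\<^sub>m k" "B * window k \<gamma> i = 1\<^sub>m k"
    using SL_inverse[OF W] .
  have Bc: "B \<in> carrier_mat k k" using B(1) by (rule SL_D)
  show ?thesis
  proof (rule ex1I[of _ "B *\<^sub>v \<gamma> (i + int k)"], intro conjI)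
    show "B *\<^sub>v \<gamma> (i + int k) \<in> carrier_vec k" using Bc g by simp
    show "\<gamma> (i + int k) = window k \<gamma> i *\<^sub>v (B *\<^sub>v \<gamma> (i + int k))"
      using assoc_mult_mat_vec[OF window_carrier[of k \<gamma> i] Bc g] B g by simp
  next
    fix c assume c: "c \<in> carrier_vec k \<and> \<gamma> (i + int k) = window k \<gamma> i *\<^sub>v c"
    then show "c = B *\<^sub>v \<gamma> (i + int k)"
      using assoc_mult_mat_vec[OF Bc window_carrier[of k \<gamma> i], of c] B by simp
  qed
qed

lemma j_coeff_eqI:
  assumes "\<gamma> \<in> paths k" "\<gamma> (i + int k) = window k \<gamma> i *\<^sub>v vec k (\<lambda>r. c (r + 1))"
    and "1 \<le> q" "q \<le> k"
  shows "j_coeff k \<gamma> i q = c q"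
proof -
  have "(THE c. c \<in> carrier_vec k \<and> \<gamma> (i + int k) = window k \<gamma> i *\<^sub>v c) = vec k (\<lambda>r. c (r + 1))"
    using assms(2) by (intro the1_equality j_coeff_ex1[OF assms(1)]) auto
  then show ?thesis using assms(3,4) by (cases q) (auto simp: j_coeff_def)
qed

lemma window_step_gen:
  assumes k: "k \<ge> 1" and A: "A \<in> carrier_mat k k"
  shows "r < k \<Longrightarrow> s < k \<Longrightarrow> (A * shift_mat k c) $$ (r, s) =
    (if s = k - 1 then (A *\<^sub>v vec k (\<lambda>r. c (r + 1))) $ r else A $$ (r, s + 1))"
proof -
  assume r: "r < k" and s: "s < k"
  show ?thesis
  proof (cases "s = k - 1")
    case True
    then show ?thesis using r s A k
      by (auto simp: shift_mat_def scalar_prod_def intro!: sum.cong)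
  next
    case False
    have "(A * shift_mat k c) $$ (r, s) = (\<Sum>t = 0..<k. A $$ (r, t) * (if t = s + 1 then 1 else 0))"
      using r s A k False by (auto simp: shift_mat_def scalar_prod_def intro!: sum.cong)
    also have "\<dots> = A $$ (r, s + 1)" using False s by (simp add: if_distrib cong: if_cong)
    finally show ?thesis using False by simp
  qed
qed

lemma window_mult_J_mat:
  assumes k: "k \<ge> 1" and g: "\<gamma> \<in> paths k"
  shows "window k \<gamma> i * J_mat k \<gamma> i = window k \<gamma> (i + 1)"
proof -
  define c where "c = (THE c. c \<in> carrier_vec k \<and> \<gamma> (i + int k) = window k \<gamma> i *\<^sub>v c)"
  have c: "c \<in> carrier_vec k" "\<gamma> (i + int k) = window k \<gamma> i *\<^sub>v c"
    using theI'[OF j_coeff_ex1[OF g, of i]] unfolding c_def by auto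
  have v: "vec k (\<lambda>r. j_coeff k \<gamma> i (r + 1)) = c"
    using c(1) by (intro eq_vecI) (auto simp: j_coeff_def c_def)
  show ?thesis
  proof (rule eq_matI)
    fix r s assume "r < dim_row (window k \<gamma> (i + 1))" "s < dim_col (window k \<gamma> (i + 1))"
    then have rs: "r < k" "s < k" by auto
    have *: "i + 1 + int s = i + int k" if "s = k - 1" using that k by simp
    show "(window k \<gamma> i * J_mat k \<gamma> i) $$ (r, s) = window k \<gamma> (i + 1) $$ (r, s)"
      unfolding J_mat_def window_step_gen[OF k window_carrier rs] v
      using rs c(2) * by (auto simp: window_index add.assoc)
  qed (auto simp: J_mat_def shift_mat_def)
qed

lemma det_shift_mat:
  assumes "k \<ge> 1"
  shows "det (shift_mat k c) = (- 1) ^ (k - 1) * c 1"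
proof -
  have "mat_delete (shift_mat k c) 0 (k - 1) = 1\<^sub>m (k - 1)"
    using assms by (intro eq_matI) (auto simp: mat_delete_def shift_mat_def)
  moreover have "det (shift_mat k c)
      = (\<Sum>s<k. shift_mat k c $$ (0, s) * cofactor (shift_mat k c) 0 s)"
    using assms by (intro laplace_expansion_row) auto
  moreover have "\<dots> = (\<Sum>s<k. if s = k - 1 then c 1 * cofactor (shift_mat k c) 0 (k - 1) else 0)"
    using assms by (intro sum.cong) (auto simp: shift_mat_def)
  ultimately show ?thesis using assms by (simp add: cofactor_def)
qed

lemma int_bi_induct:
  fixes P :: "int \<Rightarrow> bool"
  assumes "P 1" "\<And>i. P i \<Longrightarrow> P (i + 1)" "\<And>i. P (i + 1) \<Longrightarrow> P i"
  shows "P i"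
  by (induction i rule: int_induct[where k = 1])
     (use assms assms(3)[of "_ - 1"] in auto)

lemma path_eqI:
  assumes k: "k \<ge> 1" and g: "\<gamma> \<in> paths k" "\<delta> \<in> paths k"
    and "window k \<gamma> 1 = window k \<delta> 1" and J: "\<And>i. J_mat k \<gamma> i = J_mat k \<delta> i"
    and JSL: "\<And>i. J_mat k \<gamma> i \<in> SL k"
  shows "\<gamma> = \<delta>"
proof -
  have W: "window k \<gamma> i = window k \<delta> i" for i
  proof (induction i rule: int_bi_induct)
    case 1
    show ?case by fact
  next
    case (2 i)
    then show ?case using window_mult_J_mat[OF k g(1), of i] window_mult_J_mat[OF k g(2), of i] J
      by simp
  next
    case (3 i)
    obtain B where B: "B \<in> SL k" "J_mat k \<gamma> i * B = 1\<^sub>m k" using SL_inverse[OF JSL] by blast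
    have Bc: "B \<in> carrier_mat k k" using B(1) by (rule SL_D)
    have Jc: "J_mat k \<gamma> i \<in> carrier_mat k k" using JSL by (rule SL_D)
    have "window k \<gamma> i = window k \<gamma> (i + 1) * B"
      unfolding window_mult_J_mat[OF k g(1), symmetric] assoc_mult_mat[OF window_carrier Jc Bc] B
      by (rule right_mult_one_mat[OF window_carrier, symmetric])
    moreover have "window k \<delta> i = window k \<delta> (i + 1) * B"
      unfolding window_mult_J_mat[OF k g(2), symmetric] J[symmetric]
        assoc_mult_mat[OF window_carrier Jc Bc] B
      by (rule right_mult_one_mat[OF window_carrier, symmetric])
    ultimately show ?case using 3 by simp
  qed
  have "\<gamma> i = \<delta> i" for i
  proof (rule eq_vecI)
    have c: "\<gamma> i \<in> carrier_vec k" "\<delta> i \<in> carrier_vec k" using g by (auto simp: paths_def)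
    then show "dim_vec (\<gamma> i) = dim_vec (\<delta> i)" by simp
    fix r assume "r < dim_vec (\<delta> i)"
    then have "r < k" using c by simp
    then show "\<gamma> i $ r = \<delta> i $ r"
      using window_index[of r k 0 \<gamma> i] window_index[of r k 0 \<delta> i] W[of i] k by simp
  qed
  then show ?thesis by (rule ext)
qed

lemma SL_sequence:
  assumes W: "W \<in> SL k" and J: "\<And>i::int. J i \<in> SL k"
  obtains V where "V 1 = W" "\<And>i. V i \<in> SL k" "\<And>i. V (i + 1) = V i * J i"
proof -
  have "\<forall>i. \<exists>B. B \<in> SL k \<and> J i * B = 1\<^sub>m k \<and> B * J i = 1\<^sub>m k" using SL_inverse J by metis
  then obtain K where K: "\<And>i. K i \<in> SL k" "\<And>i. K i * J i = 1\<^sub>m k" by metis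
  define P where "P = rec_nat W (\<lambda>n X. X * J (int n + 1))"
  define N where "N = rec_nat W (\<lambda>n X. X * K (- int n))"
  have P: "P 0 = W" "P (Suc n) = P n * J (int n + 1)" for n by (auto simp: P_def)
  have N: "N 0 = W" "N (Suc n) = N n * K (- int n)" for n by (auto simp: N_def)
  have PSL: "P n \<in> SL k" and NSL: "N n \<in> SL k" for n
    by (induction n) (auto simp: P N W J K SL_mult)
  define V where "V i = (if i \<ge> 1 then P (nat (i - 1)) else N (nat (1 - i)))" for i :: int
  have "V (i + 1) = V i * J i" for i
  proof (cases "i \<ge> 1")
    case True
    then have "nat i = Suc (nat (i - 1))" by simp
    then show ?thesis using True P(2)[of "nat (i - 1)"] by (simp add: V_def)
  next
    case False
    define n where "n = nat (- i)"
    have i: "i = - int n" using False by (simp add: n_def)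
    have "V (i + 1) = N n" using P(1) N(1) by (auto simp: V_def i)
    moreover have "V i = N (Suc n)" by (simp add: V_def i nat_add_distrib)
    moreover have "N n * K i * J i = N n"
      using K(2)[of i] assoc_mult_mat[OF SL_D(1)[OF NSL[of n]] SL_D(1)[OF K(1)] SL_D(1)[OF J]]
        SL_D(1)[OF NSL[of n]] by simp
    ultimately show ?thesis using N(2)[of n] by (simp add: i)
  qed
  moreover have "V i \<in> SL k" for i by (simp add: V_def PSL NSL)
  moreover have "V 1 = W" by (simp add: V_def P)
  ultimately show ?thesis using that by blast
qed

lemma path_exists:
  assumes k: "k \<ge> 1" and W: "W \<in> SL k" and J: "\<And>i. shift_mat k (c i) \<in> SL k"
  obtains \<eta> where "\<eta> \<in> paths k" "window k \<eta> 1 = W" "\<And>i. J_mat k \<eta> i = shift_mat k (c i)"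
proof -
  obtain V where V: "V 1 = W" "\<And>i. V i \<in> SL k" "\<And>i. V (i + 1) = V i * shift_mat k (c i)"
    using SL_sequence[where J = "\<lambda>i. shift_mat k (c i)", OF W J] by blast
  have Vc: "V i \<in> carrier_mat k k" for i using V(2) by (rule SL_D)
  define \<eta> where "\<eta> i = col (V i) 0" for i
  have shift: "V i $$ (r, s) = V (i + int s) $$ (r, 0)" if "r < k" "s < k" for i r s
    using that
  proof (induction s arbitrary: i)
    case (Suc s)
    then have rs: "r < k" "s < k" "s \<noteq> k - 1" by auto
    have "V i $$ (r, Suc s) = V (i + 1) $$ (r, s)"
      using window_step_gen[OF k Vc[of i] rs(1,2), of "c i"] rs(3) by (simp add: V(3))
    also have "\<dots> = V (i + 1 + int s) $$ (r, 0)" by (rule Suc.IH[OF rs(1,2)])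
    also have "i + 1 + int s = i + int (Suc s)" by simp
    finally show ?case .
  qed simp
  have win: "window k \<eta> i = V i" for i
  proof (rule eq_matI)
    fix r s assume "r < dim_row (V i)" "s < dim_col (V i)"
    then have rs: "r < k" "s < k" using Vc[of i] by auto
    then show "window k \<eta> i $$ (r, s) = V i $$ (r, s)"
      using shift[OF rs, of i] Vc[of "i + int s"] by (simp add: window_index \<eta>_def)
  qed (use Vc[of i] in auto)
  have dim: "\<eta> i \<in> carrier_vec k" for i using Vc[of i] by (auto simp: \<eta>_def)
  have p: "\<eta> \<in> paths k" using win V(2) dim by (auto simp: paths_def)
  have "J_mat k \<eta> i = shift_mat k (c i)" for i
  proof -
    have eq: "\<eta> (i + int k) = window k \<eta> i *\<^sub>v vec k (\<lambda>r. c i (r + 1))"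
    proof (rule eq_vecI)
      fix r assume "r < dim_vec (window k \<eta> i *\<^sub>v vec k (\<lambda>r. c i (r + 1)))"
      then have r: "r < k" by simp
      have "\<eta> (i + int k) $ r = window k \<eta> (i + 1) $$ (r, k - 1)"
        using k r by (simp add: window_index)
      also have "\<dots> = (V i *\<^sub>v vec k (\<lambda>r. c i (r + 1))) $ r"
        using window_step_gen[OF k Vc[of i] r, of "k - 1" "c i"] k by (simp add: win V(3))
      finally show "\<eta> (i + int k) $ r = (window k \<eta> i *\<^sub>v vec k (\<lambda>r. c i (r + 1))) $ r"
        by (simp add: win)
    qed (use dim[of "i + int k"] in simp)
    show ?thesis unfolding J_mat_def
      by (intro eq_matI) (auto simp: shift_mat_def j_coeff_eqI[OF p eq])
  qed
  with p win[of 1] V(1) that show ?thesis by blast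
qed

lemma tilde_path_ex1:
  assumes k: "k \<ge> 2" and g: "\<gamma> \<in> paths k"
  shows "\<exists>!\<eta>. \<eta> \<in> paths k \<and> window k \<eta> 1 = transpose_mat (window k \<gamma> 1)
           \<and> (\<forall>i. J_mat k \<eta> i = shift_mat k (tilde_coeff k \<gamma> i))"
proof -
  have k1: "k \<ge> 1" using k by simp
  have W: "transpose_mat (window k \<gamma> 1) \<in> SL k"
    using g det_transpose[OF window_carrier[of k \<gamma> 1]] by (auto simp: paths_def SL_def)
  have J: "shift_mat k (tilde_coeff k \<gamma> i) \<in> SL k" for i
    using det_shift_mat[OF k1, of "tilde_coeff k \<gamma> i"]
    by (simp add: SL_def tilde_coeff_def power_mult_distrib[symmetric])
  obtain \<eta> where \<eta>: "\<eta> \<in> paths k" "window k \<eta> 1 = transpose_mat (window k \<gamma> 1)"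
    "\<And>i. J_mat k \<eta> i = shift_mat k (tilde_coeff k \<gamma> i)"
    using path_exists[where c = "tilde_coeff k \<gamma>", OF k1 W J] by blast
  show ?thesis
  proof (rule ex1I[of _ \<eta>])
    fix \<theta> assume "\<theta> \<in> paths k \<and> window k \<theta> 1 = transpose_mat (window k \<gamma> 1)
           \<and> (\<forall>i. J_mat k \<theta> i = shift_mat k (tilde_coeff k \<gamma> i))"
    then show "\<theta> = \<eta>" using \<eta> J by (intro path_eqI[OF k1]) auto
  qed (use \<eta> in auto)
qed

end

theory Submission
  imports Defs
begin

text \<open>
  Let \<open>n\<^sub>i\<close> (the conormal path) be the last row of the inverse of the window of \<open>\<gamma>\<close> at \<open>i\<close>, so that
  \<open>\<Phi>(\<gamma>, \<delta>)\<close> has entries \<open>n\<^sub>i \<bullet> \<delta>\<^sub>j\<close>. The sequence \<open>n\<close> is again a path, and its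
  \<open>J\<close> matrices are exactly those of \<open>tilde_path k \<gamma>\<close>; hence the two paths differ by a matrix of
  \<open>SL k\<close>. Applying the tilde construction to the coefficients twice shifts their index by
  \<open>k - 2\<close>, so the conormal path of \<open>tilde_path k \<gamma>\<close> is an \<open>SL k\<close> image of
  \<open>i \<mapsto> \<gamma>\<^bsub>i+k-2\<^esub>\<close>.
  Since \<open>\<gamma>\<^bsub>i+k-2\<^esub>\<close> is orthogonal to \<open>n\<^sub>i, \<dots>, n\<^bsub>i+k-2\<^esub>\<close>, multiplying the rows
  \<open>n\<^sub>i, \<dots>, n\<^bsub>i+k-1\<^esub>\<close> by the columns
  \<open>\<delta>\<^sub>j, \<dots>, \<delta>\<^bsub>j+k-2\<^esub>, \<gamma>\<^bsub>i+k-2\<^esub>\<close> shows that the dual tiling has entries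
  \<open>(-1)\<^bsup>k-1\<^esup> det(\<delta>\<^sub>j, \<dots>, \<delta>\<^bsub>j+k-2\<^esub>, \<gamma>\<^bsub>i+k-2\<^esub>)\<close>,
  which up to this sign pairs an \<open>SL k\<close> image of \<open>tilde_path k \<delta>\<close> at \<open>j\<close> with an \<open>SL k\<close> image of
  the conormal path of \<open>tilde_path k \<gamma>\<close> at \<open>i\<close>. The sign is absorbed in \<open>A\<close>
  because \<open>k (k - 1)\<close> is even.
\<close>

section \<open>Conormal vectors and their pairing with the path\<close>

text \<open>The adjugate stays over the integers and equals the inverse when the window has
  determinant 1. Its entries are cofactors, which lets \<open>Phi_eq_conormal\<close> hold for an
  arbitrary sequence \<open>\<gamma>\<close>.\<close>

definition conormal :: "nat \<Rightarrow> (int \<Rightarrow> int vec) \<Rightarrow> int \<Rightarrow> int vec" where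
  "conormal k \<gamma> i = row (adj_mat (window k \<gamma> i)) (k - 1)"

lemma paths_D:
  assumes "\<gamma> \<in> paths k"
  shows "\<gamma> i \<in> carrier_vec k" "window k \<gamma> i \<in> SL k" "det (window k \<gamma> i) = 1"
  using assms by (auto simp: paths_def SL_def)

lemma col_window:
  assumes "\<gamma> (i + int s) \<in> carrier_vec k" "s < k"
  shows "col (window k \<gamma> i) s = \<gamma> (i + int s)"
  using assms by (intro eq_vecI) (auto simp: window_index)

lemma adj_window_carrier [simp]: "adj_mat (window k \<gamma> i) \<in> carrier_mat k k"
  by (rule adj_mat(1)[OF window_carrier])

lemma adj_window_dim [simp]:
  "dim_row (adj_mat (window k \<gamma> i)) = k" "dim_col (adj_mat (window k \<gamma> i)) = k"
  by (rule carrier_matD[OF adj_window_carrier])+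

lemma conormal_carrier [simp]: "conormal k \<gamma> i \<in> carrier_vec k"
  by (intro carrier_vecI) (simp add: conormal_def)

lemma conormal_index:
  "r < k \<Longrightarrow> conormal k \<gamma> i $ r = adj_mat (window k \<gamma> i) $$ (k - 1, r)"
  by (simp add: conormal_def)

text \<open>Laplace expansion along the last column: its cofactors do not see that column, so
  replacing the last column of the window by \<open>\<delta> j\<close> leaves them unchanged, and
  they form the last row of the adjugate.\<close>

lemma Phi_eq_conormal:
  assumes k: "k \<ge> 1" and d: "\<delta> j \<in> carrier_vec k"
  shows "Phi k \<gamma> \<delta> i j = conormal k \<gamma> i \<bullet> \<delta> j"
proof -
  define X where "X = mat_of_cols k (map (\<lambda>q. \<gamma> (i + int q)) [0..<k - 1] @ [\<delta> j])"
  have X: "X \<in> carrier_mat k k" using k by (auto simp: X_def mat_of_cols_def)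
  have Xi: "X $$ (r, s) = (if s = k - 1 then \<delta> j $ r else \<gamma> (i + int s) $ r)"
    if "r < k" "s < k" for r s
    using that k unfolding X_def by (subst mat_of_cols_index) (auto simp: nth_append)
  have "cofactor X r (k - 1) = cofactor (window k \<gamma> i) r (k - 1)" if "r < k" for r
  proof -
    have "mat_delete X r (k - 1) = mat_delete (window k \<gamma> i) r (k - 1)"
      using X k that by (intro eq_matI) (auto simp: mat_delete_def Xi window_index)
    then show ?thesis by (simp add: cofactor_def)
  qed
  moreover have "det X = (\<Sum>r<k. X $$ (r, k - 1) * cofactor X r (k - 1))"
    using k by (intro laplace_expansion_column[OF X]) simp
  ultimately have "det X = (\<Sum>r<k. \<delta> j $ r * cofactor (window k \<gamma> i) r (k - 1))"
    using k by (simp add: Xi)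
  also have "\<dots> = conormal k \<gamma> i \<bullet> \<delta> j"
    using d k by (auto simp: scalar_prod_def conormal_index adj_mat_def mult.commute
        lessThan_atLeast0 intro!: sum.cong)
  finally show ?thesis by (simp add: Phi_def X_def)
qed

lemma adj_window_mult:
  assumes "\<gamma> \<in> paths k"
  shows "adj_mat (window k \<gamma> i) * window k \<gamma> i = 1\<^sub>m k"
    and "window k \<gamma> i * adj_mat (window k \<gamma> i) = 1\<^sub>m k"
proof -
  have "(1 :: int) \<cdot>\<^sub>m 1\<^sub>m k = 1\<^sub>m k" by (intro eq_matI) auto
  then show "adj_mat (window k \<gamma> i) * window k \<gamma> i = 1\<^sub>m k"
    and "window k \<gamma> i * adj_mat (window k \<gamma> i) = 1\<^sub>m k"
    using adj_mat(2,3)[OF window_carrier[of k \<gamma> i]] paths_D(3)[OF assms, of i] by simp_all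
qed

lemma adj_window_row_scalar:
  assumes g: "\<gamma> \<in> paths k" and "p < k" "s < k"
  shows "row (adj_mat (window k \<gamma> i)) p \<bullet> \<gamma> (i + int s) = (if p = s then 1 else 0)"
proof -
  have "col (window k \<gamma> i) s = \<gamma> (i + int s)"
    by (rule col_window[OF paths_D(1)[OF g] assms(3)])
  moreover have "(adj_mat (window k \<gamma> i) * window k \<gamma> i) $$ (p, s)
      = row (adj_mat (window k \<gamma> i)) p \<bullet> col (window k \<gamma> i) s"
    using assms by simp
  ultimately show ?thesis using assms by (simp add: adj_window_mult(1))
qed

lemma conormal_scalar:
  assumes "\<gamma> \<in> paths k" "s < k"
  shows "conormal k \<gamma> i \<bullet> \<gamma> (i + int s) = (if s = k - 1 then 1 else 0)"
  using adj_window_row_scalar[of \<gamma> k "k - 1" s i] assms by (auto simp: conormal_def)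

section \<open>J matrices and the recurrence of the conormal path\<close>

lemma J_mat_SL:
  assumes k: "k \<ge> 1" and g: "\<gamma> \<in> paths k"
  shows "J_mat k \<gamma> i \<in> SL k"
proof -
  have J: "J_mat k \<gamma> i \<in> carrier_mat k k" by (simp add: J_mat_def)
  have "det (window k \<gamma> i) * det (J_mat k \<gamma> i) = det (window k \<gamma> (i + 1))"
    unfolding window_mult_J_mat[OF k g, symmetric] by (rule det_mult[OF window_carrier J, symmetric])
  then show ?thesis using J paths_D(3)[OF g] by (simp add: SL_def)
qed

lemma j_coeff_1:
  assumes k: "k \<ge> 1" and g: "\<gamma> \<in> paths k"
  shows "j_coeff k \<gamma> i 1 = (- 1) ^ (k - 1)"
proof -
  have "(- 1) ^ (k - 1) * j_coeff k \<gamma> i 1 = 1"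
    using J_mat_SL[OF assms, of i] det_shift_mat[OF k, of "j_coeff k \<gamma> i"]
    by (simp add: J_mat_def SL_def)
  then have "(- 1) ^ (k - 1) * ((- 1) ^ (k - 1) * j_coeff k \<gamma> i 1) = (- 1) ^ (k - 1)" by simp
  then show ?thesis unfolding mult.assoc[symmetric] minus_one_mult_self by simp
qed

text \<open>Multiplication by a shift matrix from the left moves every row down by one and adds
  multiples of the old last row. For adjugates of windows that last row is the conormal
  vector.\<close>

lemma shift_mat_mult_index:
  assumes B: "B \<in> carrier_mat k k" and pc: "p < k" "c < k"
  shows "(shift_mat k f * B) $$ (p, c)
    = (if p = 0 then 0 else B $$ (p - 1, c)) + f (p + 1) * B $$ (k - 1, c)"
proof -
  obtain m where m: "k = Suc m" using pc by (cases k) auto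
  have "(shift_mat k f * B) $$ (p, c) = (\<Sum>s<k. shift_mat k f $$ (p, s) * B $$ (s, c))"
    using B pc by (auto simp: scalar_prod_def shift_mat_def lessThan_atLeast0 intro!: sum.cong)
  also have "\<dots> = (\<Sum>s<m. if p = s + 1 then B $$ (s, c) else 0) + f (p + 1) * B $$ (k - 1, c)"
    using pc by (auto simp: m shift_mat_def intro!: sum.cong)
  also have "(\<Sum>s<m. if p = s + 1 then B $$ (s, c) else 0) = (if p = 0 then 0 else B $$ (p - 1, c))"
  proof (cases p)
    case (Suc q)
    then have "q < m" using pc m by simp
    then show ?thesis using Suc by simp
  qed simp
  finally show ?thesis .
qed

text \<open>This is \<open>window_mult_J_mat\<close> after inverting both windows.\<close>

lemma adj_window_step:
  assumes k: "k \<ge> 1" and g: "\<gamma> \<in> paths k"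
  shows "adj_mat (window k \<gamma> i) = J_mat k \<gamma> i * adj_mat (window k \<gamma> (i + 1))"
proof -
  let ?B = "adj_mat (window k \<gamma> i)" and ?C = "adj_mat (window k \<gamma> (i + 1))"
  have J: "J_mat k \<gamma> i \<in> carrier_mat k k" by (simp add: J_mat_def)
  have "?B = ?B * (window k \<gamma> (i + 1) * ?C)"
    by (simp add: adj_window_mult(2)[OF g])
  also have "\<dots> = ?B * (window k \<gamma> i * (J_mat k \<gamma> i * ?C))"
    using window_mult_J_mat[OF k g, of i]
      assoc_mult_mat[OF window_carrier[of k \<gamma> i] J adj_window_carrier] by simp
  also have "\<dots> = (?B * window k \<gamma> i) * (J_mat k \<gamma> i * ?C)"
    by (rule assoc_mult_mat[symmetric, of _ k k _ k _ k]) (use J in auto)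
  also have "\<dots> = J_mat k \<gamma> i * ?C"
    using J by (simp add: adj_window_mult(1)[OF g])
  finally show ?thesis .
qed

lemma adj_window_step_index:
  assumes k: "k \<ge> 1" and g: "\<gamma> \<in> paths k" and pc: "p < k" "c < k"
  shows "adj_mat (window k \<gamma> i) $$ (p, c) =
    (if p = 0 then 0 else adj_mat (window k \<gamma> (i + 1)) $$ (p - 1, c))
      + j_coeff k \<gamma> i (p + 1) * conormal k \<gamma> (i + 1) $ c"
  unfolding adj_window_step[OF k g, of i] J_mat_def
    shift_mat_mult_index[OF adj_window_carrier pc] conormal_index[OF pc(2)] ..

text \<open>By the step formula, row 0 of the inverse window at \<open>i\<close> is
  \<open>j_coeff k \<gamma> i 1\<close>, a sign, times the next conormal vector; that row pairs to 1
  with \<open>\<gamma> i\<close>.\<close>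

lemma conormal_scalar_prev:
  assumes k: "k \<ge> 1" and g: "\<gamma> \<in> paths k"
  shows "conormal k \<gamma> (i + 1) \<bullet> \<gamma> i = (- 1) ^ (k - 1)"
proof -
  have "row (adj_mat (window k \<gamma> i)) 0 = (- 1) ^ (k - 1) \<cdot>\<^sub>v conormal k \<gamma> (i + 1)"
    using k adj_window_step_index[OF k g, of 0 _ i] j_coeff_1[OF k g, of i]
    by (intro eq_vecI) (auto simp: conormal_def)
  then have "(- 1) ^ (k - 1) * (conormal k \<gamma> (i + 1) \<bullet> \<gamma> i) = 1"
    using adj_window_row_scalar[OF g, of 0 0 i] k paths_D(1)[OF g, of i] by simp
  then have "(- 1) ^ (k - 1) * ((- 1) ^ (k - 1) * (conormal k \<gamma> (i + 1) \<bullet> \<gamma> i)) = (- 1) ^ (k - 1)"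
    by simp
  then show ?thesis unfolding mult.assoc[symmetric] minus_one_mult_self by simp
qed

lemma conormal_in_paths:
  assumes k: "k \<ge> 1" and g: "\<gamma> \<in> paths k"
  shows "conormal k \<gamma> \<in> paths k"
proof -
  have "window k (conormal k \<gamma>) i \<in> SL k" for i
  proof -
    \<comment> \<open>the pairing with the window of \<open>\<gamma>\<close> at \<open>i + k - 1\<close> is upper unitriangular\<close>
    let ?N = "window k (conormal k \<gamma>) i" and ?W = "window k \<gamma> (i + int (k - 1))"
    let ?X = "transpose_mat ?N * ?W"
    have X: "?X \<in> carrier_mat k k" by (intro carrier_matI) simp_all
    have Xi: "?X $$ (s, r) = (if r = s then 1 else 0)" if "r \<le> s" "s < k" for r s
    proof -
      have "col ?N s = conormal k \<gamma> (i + int s)"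
        by (rule col_window[OF conormal_carrier that(2)])
      \<comment> \<open>The index is rewritten as a position in the window of
        \<open>\<gamma>\<close> at \<open>i + int s\<close>, the form \<open>conormal_scalar\<close>
        needs. The natural subtractions are exact because r <= s < k.\<close>
      moreover have "col ?W r = \<gamma> ((i + int s) + int (k - 1 - (s - r)))"
      proof -
        have *: "(i + int s) + int (k - 1 - (s - r)) = i + int (k - 1) + int r" using that by auto
        show ?thesis unfolding *
          using that by (intro col_window paths_D(1)[OF g]) simp
      qed
      ultimately have "?X $$ (s, r) = conormal k \<gamma> (i + int s) \<bullet> \<gamma> ((i + int s) + int (k - 1 - (s - r)))"
        using that by simp
      also have "\<dots> = (if k - 1 - (s - r) = k - 1 then 1 else 0)"
        using that by (intro conormal_scalar[OF g]) auto
      also have "k - 1 - (s - r) = k - 1 \<longleftrightarrow> r = s" using that by auto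
      finally show ?thesis .
    qed
    have "upper_triangular ?X" using Xi by auto
    then have "det ?X = prod_list (diag_mat ?X)" by (rule det_upper_triangular[OF _ X])
    also have "diag_mat ?X = map (\<lambda>_. 1) [0..<k]" using Xi by (auto simp: diag_mat_def)
    finally have "det ?X = 1" by (simp add: map_replicate_const)
    moreover have "det ?X = det ?N * det ?W"
      by (subst det_mult[of _ k]) (auto simp: det_transpose[OF window_carrier])
    ultimately show ?thesis using paths_D(3)[OF g] by (simp add: SL_def)
  qed
  then show ?thesis by (simp add: paths_def)
qed

text \<open>Each use of the step formula moves the tracked row up by one and splits off a multiple
  of a later conormal vector. At m = k - 1 the tracked row is row 0, where the recursion
  closes.\<close>

lemma conormal_unroll:
  assumes k: "k \<ge> 1" and g: "\<gamma> \<in> paths k" and c: "c < k" and m: "m < k"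
  shows "conormal k \<gamma> i $ c = adj_mat (window k \<gamma> (i + int m)) $$ (k - 1 - m, c)
    + (\<Sum>s<m. j_coeff k \<gamma> (i + int s) (k - s) * conormal k \<gamma> (i + int s + 1) $ c)"
  using m
proof (induction m)
  case 0
  then show ?case using c by (simp add: conormal_index)
next
  case (Suc m)
  have *: "k - 1 - m < k" "k - 1 - m \<noteq> 0" "k - 1 - m - 1 = k - 1 - Suc m" "k - 1 - m + 1 = k - m"
    "i + int m + 1 = i + int (Suc m)"
    using Suc.prems by auto
  show ?case
    using Suc adj_window_step_index[OF k g *(1) c, of "i + int m"] * by (simp add: algebra_simps)
qed

lemma conormal_recurrence:
  assumes k: "k \<ge> 2" and g: "\<gamma> \<in> paths k"
  shows "conormal k \<gamma> (i + int k)
    = window k (conormal k \<gamma>) i *\<^sub>v vec k (\<lambda>r. tilde_coeff k \<gamma> i (r + 1))"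
proof (rule eq_vecI)
  let ?d = "conormal k \<gamma>"
  fix c assume "c < dim_vec (window k ?d i *\<^sub>v vec k (\<lambda>r. tilde_coeff k \<gamma> i (r + 1)))"
  then have c: "c < k" by simp
  have k1: "k \<ge> 1" using k by simp
  obtain m where m: "k = Suc m" using k by (cases k) auto
  let ?e = "(- 1) ^ m :: int"
  let ?S = "\<Sum>s<m. j_coeff k \<gamma> (i + int s) (k - s) * ?d (i + int s + 1) $ c"
  \<comment> \<open>With m = k - 1 the remaining row 0 at \<open>i + int m\<close> is
    \<open>?e\<close> times the conormal vector at \<open>i + int k\<close>. Since \<open>?e\<close>
    is its own inverse, the relation can be solved for that vector.\<close>
  have "?d i $ c = ?e * ?d (i + int k) $ c + ?S"
    using conormal_unroll[OF k1 g c, of m i] adj_window_step_index[OF k1 g _ c, of 0 "i + int m"]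
      j_coeff_1[OF k1 g, of "i + int m"] by (simp add: m algebra_simps)
  then have "?e * (?e * ?d (i + int k) $ c) = ?e * (?d i $ c - ?S)" by simp
  then have d: "?d (i + int k) $ c = ?e * ?d i $ c - ?e * ?S"
    unfolding mult.assoc[symmetric] minus_one_mult_self by (simp add: algebra_simps)
  have "(window k ?d i *\<^sub>v vec k (\<lambda>r. tilde_coeff k \<gamma> i (r + 1))) $ c
      = (\<Sum>r<Suc m. ?d (i + int r) $ c * tilde_coeff k \<gamma> i (r + 1))"
    using c unfolding m[symmetric]
    by (auto simp: scalar_prod_def window_index lessThan_atLeast0 intro!: sum.cong)
  also have "\<dots> = ?d i $ c * ?e + (\<Sum>s<m. ?d (i + int (Suc s)) $ c * tilde_coeff k \<gamma> i (Suc s + 1))"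
    unfolding sum.lessThan_Suc_shift by (simp add: tilde_coeff_def m)
  also have "(\<Sum>s<m. ?d (i + int (Suc s)) $ c * tilde_coeff k \<gamma> i (Suc s + 1)) = - (?e * ?S)"
    unfolding sum_distrib_left sum_negf[symmetric]
  proof (rule sum.cong[OF refl])
    fix s assume "s \<in> {..<m}"
    \<comment> \<open>The coefficient with q = s + 2 is (-1)^k times the one at
      \<open>i + int s\<close> and \<open>k - s\<close>. The minus sign in the sum comes from (-1)^k
      = -(-1)^m.\<close>
    then have s: "k - (Suc s + 1) + 2 = k - s" "i + int (Suc s + 1) - 2 = i + int s"
      "i + int (Suc s) = i + int s + 1" using m by auto
    show "?d (i + int (Suc s)) $ c * tilde_coeff k \<gamma> i (Suc s + 1)
      = - (?e * (j_coeff k \<gamma> (i + int s) (k - s) * ?d (i + int s + 1) $ c))"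
      unfolding tilde_coeff_def s by (simp add: m)
  qed
  finally show "?d (i + int k) $ c = (window k ?d i *\<^sub>v vec k (\<lambda>r. tilde_coeff k \<gamma> i (r + 1))) $ c"
    using d by simp
qed (use conormal_carrier[of k \<gamma> "i + int k"] in simp)

lemma j_coeff_conormal:
  assumes k: "k \<ge> 2" and g: "\<gamma> \<in> paths k" and q: "1 \<le> q" "q \<le> k"
  shows "j_coeff k (conormal k \<gamma>) i q = tilde_coeff k \<gamma> i q"
  using j_coeff_eqI[OF conormal_in_paths[OF _ g] conormal_recurrence[OF k g] q] k by simp

section \<open>The SL_k action and paths with equal J matrices\<close>

lemma shift_mat_cong:
  "(\<And>q. 1 \<le> q \<Longrightarrow> q \<le> k \<Longrightarrow> c q = d q) \<Longrightarrow> shift_mat k c = shift_mat k d"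
  by (intro eq_matI) (auto simp: shift_mat_def)

lemma shift_mat_eqD:
  assumes "shift_mat k c = shift_mat k d" "1 \<le> q" "q \<le> k"
  shows "c q = d q"
proof -
  have "shift_mat k c $$ (q - 1, k - 1) = shift_mat k d $$ (q - 1, k - 1)" using assms by simp
  then show ?thesis using assms(2,3) by (simp add: shift_mat_def)
qed

lemma tilde_path:
  assumes k: "k \<ge> 2" and g: "\<gamma> \<in> paths k"
  shows "tilde_path k \<gamma> \<in> paths k" "J_mat k (tilde_path k \<gamma>) i = shift_mat k (tilde_coeff k \<gamma> i)"
  using theI'[OF tilde_path_ex1[OF assms]] unfolding tilde_path_def by auto

lemma mat_act_carrier:
  assumes A: "A \<in> carrier_mat k k" and g: "\<gamma> i \<in> carrier_vec k"
  shows "mat_act A \<gamma> i \<in> carrier_vec k"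
  using assms by (simp add: mat_act_def)

lemma window_mat_act:
  assumes A: "A \<in> carrier_mat k k" and g: "\<And>i. \<gamma> i \<in> carrier_vec k"
  shows "window k (mat_act A \<gamma>) i = A * window k \<gamma> i"
proof (rule eq_matI)
  fix r s assume "r < dim_row (A * window k \<gamma> i)" "s < dim_col (A * window k \<gamma> i)"
  then have rs: "r < k" "s < k" using A by auto
  have "col (window k \<gamma> i) s = \<gamma> (i + int s)"
    by (rule col_window[OF g rs(2)])
  then show "window k (mat_act A \<gamma>) i $$ (r, s) = (A * window k \<gamma> i) $$ (r, s)"
    using rs A by (simp add: window_index mat_act_def)
qed (use A in auto)

lemma mat_act_in_paths:
  assumes A: "A \<in> SL k" and g: "\<gamma> \<in> paths k"
  shows "mat_act A \<gamma> \<in> paths k"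
  using assms SL_mult[OF A] window_mat_act[OF SL_D(1)[OF A], of \<gamma>]
    mat_act_carrier[OF SL_D(1)[OF A], of \<gamma>] by (simp add: paths_def)

text \<open>A linear map carries the recurrence of \<open>\<gamma>\<close> to the same recurrence,
  and its coefficients are unique.\<close>

lemma J_mat_act:
  assumes A: "A \<in> SL k" and g: "\<gamma> \<in> paths k"
  shows "J_mat k (mat_act A \<gamma>) i = J_mat k \<gamma> i"
proof -
  have Ac: "A \<in> carrier_mat k k" by (rule SL_D(1)[OF A])
  let ?c = "THE c. c \<in> carrier_vec k \<and> \<gamma> (i + int k) = window k \<gamma> i *\<^sub>v c"
  have c: "?c \<in> carrier_vec k" "\<gamma> (i + int k) = window k \<gamma> i *\<^sub>v ?c"
    using theI'[OF j_coeff_ex1[OF g, of i]] by auto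
  have v: "vec k (\<lambda>r. j_coeff k \<gamma> i (r + 1)) = ?c"
    using c(1) by (intro eq_vecI) (auto simp: j_coeff_def)
  have "mat_act A \<gamma> (i + int k) = A *\<^sub>v (window k \<gamma> i *\<^sub>v ?c)"
    using c(2) by (simp add: mat_act_def)
  also have "\<dots> = window k (mat_act A \<gamma>) i *\<^sub>v vec k (\<lambda>r. j_coeff k \<gamma> i (r + 1))"
    unfolding v window_mat_act[OF Ac paths_D(1)[OF g]]
    by (rule assoc_mult_mat_vec[OF Ac window_carrier c(1), symmetric])
  finally have "mat_act A \<gamma> (i + int k)
    = window k (mat_act A \<gamma>) i *\<^sub>v vec k (\<lambda>r. j_coeff k \<gamma> i (r + 1))" .
  then show ?thesis
    unfolding J_mat_def by (intro shift_mat_cong j_coeff_eqI[OF mat_act_in_paths[OF A g]])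
qed

text \<open>A path is determined by its window at 1 and its J matrices, so it suffices to match the
  windows at 1; \<open>A\<close> is one window times the inverse of the other.\<close>

lemma paths_same_J_mat:
  assumes k: "k \<ge> 1" and g: "\<gamma> \<in> paths k" "\<delta> \<in> paths k"
    and J: "\<And>i. J_mat k \<gamma> i = J_mat k \<delta> i"
  obtains A where "A \<in> SL k" "\<gamma> = mat_act A \<delta>"
proof -
  obtain B where B: "B \<in> SL k" "B * window k \<delta> 1 = 1\<^sub>m k"
    using SL_inverse[OF paths_D(2)[OF g(2)]] by metis
  let ?A = "window k \<gamma> 1 * B"
  have A: "?A \<in> SL k" by (rule SL_mult[OF paths_D(2)[OF g(1)] B(1)])
  have "window k (mat_act ?A \<delta>) 1 = window k \<gamma> 1"
    unfolding window_mat_act[OF SL_D(1)[OF A] paths_D(1)[OF g(2)]]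
      assoc_mult_mat[OF window_carrier SL_D(1)[OF B(1)] window_carrier] B(2)
    by (rule right_mult_one_mat[OF window_carrier])
  then have "\<gamma> = mat_act ?A \<delta>"
    by (intro path_eqI[OF k g(1) mat_act_in_paths[OF A g(2)]])
      (simp_all add: J_mat_act[OF A g(2)] J[symmetric] J_mat_SL[OF k g(1)])
  with A that show ?thesis by blast
qed

lemma conormal_eq_tilde_path:
  assumes k: "k \<ge> 2" and g: "\<gamma> \<in> paths k"
  obtains B where "B \<in> SL k" "conormal k \<gamma> = mat_act B (tilde_path k \<gamma>)"
proof -
  have k1: "k \<ge> 1" using k by simp
  show ?thesis
  proof (rule paths_same_J_mat[OF k1 conormal_in_paths[OF k1 g] tilde_path(1)[OF k g]])
    show "J_mat k (conormal k \<gamma>) i = J_mat k (tilde_path k \<gamma>) i" for i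
      unfolding tilde_path(2)[OF k g] J_mat_def[of k "conormal k \<gamma>"]
      by (intro shift_mat_cong j_coeff_conormal[OF k g])
  qed (rule that)
qed

lemma conormal_tilde_path:
  assumes k: "k \<ge> 2" and g: "\<gamma> \<in> paths k"
  obtains E where "E \<in> SL k"
    "conormal k (tilde_path k \<gamma>) = mat_act E (\<lambda>i. \<gamma> (i + int k - 2))"
proof -
  have k1: "k \<ge> 1" using k by simp
  let ?t = "tilde_path k \<gamma>" and ?s = "\<lambda>i. \<gamma> (i + int k - 2)"
  note t = tilde_path[OF k g]
  have tc: "j_coeff k ?t i q = tilde_coeff k \<gamma> i q" if "1 \<le> q" "q \<le> k" for i q
    using t(2)[of i] that unfolding J_mat_def by (rule shift_mat_eqD)
  have ws: "window k ?s i = window k \<gamma> (i + int k - 2)" for i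
    by (simp add: window_def algebra_simps)
  have s: "?s \<in> paths k" using g by (simp add: paths_def ws)
  have sc: "j_coeff k ?s i q = j_coeff k \<gamma> (i + int k - 2) q" for i q
    unfolding j_coeff_def ws by (simp add: algebra_simps)
  have "tilde_coeff k ?t i q = j_coeff k ?s i q" if q: "1 \<le> q" "q \<le> k" for i q
  proof (cases "q = 1")
    case True
    then show ?thesis using j_coeff_1[OF k1 s] by (simp add: tilde_coeff_def)
  next
    case False
    \<comment> \<open>The map q to k - q + 2 is an involution of {2, ..., k}, and the two index
      shifts q - 2 and k - q add up to k - 2. The case q = 1 lies outside this range.\<close>
    have idx: "i + int q - 2 + int (k - q + 2) - 2 = i + int k - 2" "k - (k - q + 2) + 2 = q"
      using q False by auto
    have "tilde_coeff k ?t i q = (- 1) ^ k * tilde_coeff k \<gamma> (i + int q - 2) (k - q + 2)"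
      using q False by (subst tilde_coeff_def) (simp add: tc)
    also have "\<dots> = (- 1) ^ k * ((- 1) ^ k * j_coeff k \<gamma> (i + int k - 2) q)"
      unfolding tilde_coeff_def[of k \<gamma>] idx by simp
    also have "\<dots> = j_coeff k \<gamma> (i + int k - 2) q"
      unfolding mult.assoc[symmetric] minus_one_mult_self by simp
    finally show ?thesis by (simp add: sc)
  qed
  then have "J_mat k (conormal k ?t) i = J_mat k ?s i" for i
    unfolding J_mat_def by (intro shift_mat_cong) (simp add: j_coeff_conormal[OF k t(1)])
  then show ?thesis
    using paths_same_J_mat[OF k1 conormal_in_paths[OF k1 t(1)] s] that by blast
qed

section \<open>Invariance of \<open>Phi\<close> and the dual tiling as a pairing\<close>

lemma smult_mat_mult_vec:
  fixes A :: "'a :: comm_semiring_0 mat"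
  assumes "A \<in> carrier_mat n m" "v \<in> carrier_vec m"
  shows "(c \<cdot>\<^sub>m A) *\<^sub>v v = c \<cdot>\<^sub>v (A *\<^sub>v v)"
  using assms by (intro eq_vecI) (auto simp: scalar_prod_def sum_distrib_left mult.assoc)

lemma Phi_mat_act:
  assumes k: "k \<ge> 1" and A: "A \<in> SL k"
    and g: "\<And>i. \<gamma> i \<in> carrier_vec k" and d: "\<And>i. \<delta> i \<in> carrier_vec k"
  shows "Phi k (mat_act A \<gamma>) (mat_act A \<delta>) i j = Phi k \<gamma> \<delta> i j"
proof -
  let ?vs = "map (\<lambda>q. \<gamma> (i + int q)) [0..<k - 1] @ [\<delta> j]"
  have Ac: "A \<in> carrier_mat k k" by (rule SL_D(1)[OF A])
  have len: "length ?vs = k" using k by simp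
  have X: "mat_of_cols k ?vs \<in> carrier_mat k k" using len by (metis mat_of_cols_carrier(1))
  have vs: "set ?vs \<subseteq> carrier_vec k" using g d by auto
  have "map (\<lambda>q. mat_act A \<gamma> (i + int q)) [0..<k - 1] @ [mat_act A \<delta> j] = map (\<lambda>v. A *\<^sub>v v) ?vs"
    by (simp add: mat_act_def)
  moreover have "mat_of_cols k (map (\<lambda>v. A *\<^sub>v v) ?vs) = A * mat_of_cols k ?vs"
  proof (rule eq_matI)
    fix r s assume "r < dim_row (A * mat_of_cols k ?vs)" "s < dim_col (A * mat_of_cols k ?vs)"
    then have rs: "r < k" "s < length ?vs" using Ac by auto
    then have "?vs ! s \<in> carrier_vec k" using vs nth_mem by blast
    then show "mat_of_cols k (map (\<lambda>v. A *\<^sub>v v) ?vs) $$ (r, s) = (A * mat_of_cols k ?vs) $$ (r, s)"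
      using rs Ac by (simp add: mat_of_cols_index del: map_append)
  qed (use Ac in auto)
  ultimately show ?thesis
    unfolding Phi_def using det_mult[OF Ac X] SL_D(2)[OF A] by (simp only: mult_1_left)
qed

lemma tiling_dual_Phi:
  assumes k: "k \<ge> 2" and g: "\<gamma> \<in> paths k" and d: "\<delta> \<in> paths k"
  shows "tiling_dual k (Phi k \<gamma> \<delta>) i j
    = (- 1) ^ (k - 1) * (conormal k \<delta> j \<bullet> \<gamma> (i + int k - 2))"
proof -
  have k1: "k \<ge> 1" using k by simp
  let ?y = "\<gamma> (i + int k - 2)" and ?n = "conormal k \<gamma>"
  let ?D = "mat_of_cols k (map (\<lambda>q. \<delta> (j + int q)) [0..<k - 1] @ [?y])"
  let ?N = "window k ?n i"
  let ?X = "transpose_mat ?N * ?D"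
  let ?T = "mat (k - 1) (k - 1) (\<lambda>(a, b). Phi k \<gamma> \<delta> (i + int a) (j + int b))"
  have D: "?D \<in> carrier_mat k k" using k by (auto simp: mat_of_cols_def)
  have X: "?X \<in> carrier_mat k k" using carrier_matD[OF D] by (intro carrier_matI) simp_all
  have colN: "col ?N a = ?n (i + int a)" if "a < k" for a
    by (rule col_window[OF conormal_carrier that])
  have colD: "col ?D b = (if b = k - 1 then ?y else \<delta> (j + int b))" if "b < k" for b
    using that k paths_D(1)[OF g] paths_D(1)[OF d]
    by (subst col_mat_of_cols) (auto simp: nth_append)
  have Xi: "?X $$ (a, b) = ?n (i + int a) \<bullet> (if b = k - 1 then ?y else \<delta> (j + int b))"
    if "a < k" "b < k" for a b
    using that D colN[of a] colD[of b] by simp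
  \<comment> \<open>\<open>?y\<close> sits at position k - 2 - a of the window at
    \<open>i + int a\<close>, never at the last position k - 1, where the pairing would be
    1.\<close>
  have zero: "?X $$ (a, k - 1) = 0" if "a < k - 1" for a
  proof -
    have *: "i + int k - 2 = i + int a + int (k - 2 - a)" using that by auto
    show ?thesis
      using that conormal_scalar[OF g, of "k - 2 - a" "i + int a"]
      by (subst Xi) (auto simp: *)
  qed
  \<comment> \<open>The last conormal vector has index one more than that of \<open>?y\<close>,
    which is the case of \<open>conormal_scalar_prev\<close>.\<close>
  have corner: "?X $$ (k - 1, k - 1) = (- 1) ^ (k - 1)"
  proof -
    have *: "i + int (k - 1) = (i + int k - 2) + 1" using k by simp
    have "?X $$ (k - 1, k - 1) = ?n (i + int (k - 1)) \<bullet> ?y" using k by (subst Xi) auto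
    then show ?thesis unfolding * conormal_scalar_prev[OF k1 g] .
  qed
  have del: "mat_delete ?X (k - 1) (k - 1) = ?T"
  proof (rule eq_matI)
    fix a b assume "a < dim_row ?T" "b < dim_col ?T"
    then have ab: "a < k - 1" "b < k - 1" by auto
    have "mat_delete ?X (k - 1) (k - 1) $$ (a, b) = ?X $$ (a, b)"
      using ab D by (simp add: mat_delete_def)
    also have "\<dots> = ?T $$ (a, b)"
      using ab by (subst Xi) (auto simp: Phi_eq_conormal[OF k1 paths_D(1)[OF d]])
    finally show "mat_delete ?X (k - 1) (k - 1) $$ (a, b) = ?T $$ (a, b)" .
  qed (use D in \<open>auto simp: mat_delete_def\<close>)
  have "det ?X = (\<Sum>a<k. ?X $$ (a, k - 1) * cofactor ?X a (k - 1))"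
    using k by (intro laplace_expansion_column[OF X]) simp
  also have "\<dots> = (\<Sum>a<k. if a = k - 1 then (- 1) ^ (k - 1) * cofactor ?X (k - 1) (k - 1) else 0)"
    by (rule sum.cong[OF refl]) (use zero corner in auto)
  also have "\<dots> = (- 1) ^ (k - 1) * det ?T"
    using k unfolding cofactor_def del by simp
  finally have "det ?X = (- 1) ^ (k - 1) * det ?T" .
  moreover have "det ?X = det ?N * det ?D"
    using det_mult[of "transpose_mat ?N" k ?D] D by (simp add: det_transpose[OF window_carrier])
  moreover have "det ?N = 1" by (rule paths_D(3)[OF conormal_in_paths[OF k1 g]])
  \<comment> \<open>\<open>det ?D\<close> is itself an entry of
    \<open>Phi k \<delta> \<gamma>\<close>, with the two paths exchanged.\<close>
  moreover have "det ?D = conormal k \<delta> j \<bullet> ?y"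
    using Phi_eq_conormal[OF k1 paths_D(1)[OF g], where \<gamma> = \<delta> and i = j] by (simp add: Phi_def)
  ultimately have "(- 1) ^ (k - 1) * (conormal k \<delta> j \<bullet> ?y)
    = ((- 1) ^ (k - 1) * (- 1) ^ (k - 1)) * det ?T" by (simp only: mult_1_left mult.assoc)
  then show ?thesis
    unfolding minus_one_mult_self by (simp add: tiling_dual_def adjacent_minor_def)
qed

theorem theorem1p3:
  fixes k :: nat and \<gamma> \<delta> :: "int \<Rightarrow> int vec" and M :: "int \<Rightarrow> int \<Rightarrow> int"
  assumes "k \<ge> 2"
    and "\<gamma> \<in> paths k" and "\<delta> \<in> paths k"
    and "M = Phi k \<gamma> \<delta>"
  shows "\<exists>A \<in> SL k. tiling_dual k M = Phi k (mat_act A (tilde_path k \<gamma>)) (tilde_path k \<delta>)"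
proof -
  note k = assms(1) and g = assms(2) and d = assms(3)
  have k1: "k \<ge> 1" using k by simp
  let ?g = "tilde_path k \<gamma>" and ?d = "tilde_path k \<delta>" and ?e = "(- 1) ^ (k - 1) :: int"
  have gc: "?g i \<in> carrier_vec k" and dc: "?d i \<in> carrier_vec k" for i
    using tilde_path(1)[OF k g] tilde_path(1)[OF k d] by (auto dest: paths_D(1))
  obtain B where B: "B \<in> SL k" "conormal k \<delta> = mat_act B ?d"
    using conormal_eq_tilde_path[OF k d] .
  obtain E where E: "E \<in> SL k" "conormal k ?g = mat_act E (\<lambda>i. \<gamma> (i + int k - 2))"
    using conormal_tilde_path[OF k g] .
  obtain F where F: "F \<in> SL k" "F * E = 1\<^sub>m k" using SL_inverse[OF E(1)] by metis
  note Bc = SL_D(1)[OF B(1)] and Ec = SL_D(1)[OF E(1)] and Fc = SL_D(1)[OF F(1)]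
  \<comment> \<open>\<open>C\<close> collects all that acts on \<open>?d j\<close> once
    \<open>F\<close> is moved across the scalar product by transposition.\<close>
  define C where "C = ?e \<cdot>\<^sub>m (transpose_mat F * B)"
  have "transpose_mat F \<in> SL k" using F(1) by (auto simp: SL_def det_transpose)
  then have "det (transpose_mat F * B) = 1" by (rule SL_D(2)[OF SL_mult[OF _ B(1)]])
  moreover have "?e ^ k = 1" by (simp add: power_mult[symmetric])
  ultimately have C: "C \<in> SL k" using Bc Fc by (simp add: C_def SL_def)
  \<comment> \<open>Acting with the inverse of \<open>C\<close> on both arguments of
    \<open>Phi\<close> keeps its value, cancels \<open>C\<close> in the second and leaves
    \<open>A\<close> on the first.\<close>
  obtain A where A: "A \<in> SL k" "A * C = 1\<^sub>m k" using SL_inverse[OF C] by metis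
  note Ac = SL_D(1)[OF A(1)] and Cc = SL_D(1)[OF C]
  have "tiling_dual k M i j = Phi k (mat_act A ?g) ?d i j" for i j
  proof -
    have y: "\<gamma> (i + int k - 2) = F *\<^sub>v conormal k ?g i"
      using assoc_mult_mat_vec[OF Fc Ec paths_D(1)[OF g]] paths_D(1)[OF g]
      by (simp add: E(2) mat_act_def F(2))
    have "tiling_dual k M i j = ?e * ((B *\<^sub>v ?d j) \<bullet> (F *\<^sub>v conormal k ?g i))"
      unfolding assms(4) tiling_dual_Phi[OF k g d] y B(2) by (simp add: mat_act_def)
    also have "\<dots> = ?e * ((transpose_mat F *\<^sub>v (B *\<^sub>v ?d j)) \<bullet> conormal k ?g i)"
      using Bc dc by (subst transpose_vec_mult_scalar[OF Fc]) auto
    also have "transpose_mat F *\<^sub>v (B *\<^sub>v ?d j) = (transpose_mat F * B) *\<^sub>v ?d j"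
      using Fc Bc dc by (intro assoc_mult_mat_vec[symmetric]) auto
    also have "?e * (((transpose_mat F * B) *\<^sub>v ?d j) \<bullet> conormal k ?g i)
        = (C *\<^sub>v ?d j) \<bullet> conormal k ?g i"
    proof -
      have "C *\<^sub>v ?d j = ?e \<cdot>\<^sub>v ((transpose_mat F * B) *\<^sub>v ?d j)"
        unfolding C_def using Fc Bc dc[of j]
        by (intro smult_mat_mult_vec[of _ k k]) auto
      then show ?thesis using Fc Bc dc[of j]
        by (simp add: smult_scalar_prod_distrib[of _ k])
    qed
    also have "\<dots> = conormal k ?g i \<bullet> mat_act C ?d j"
      unfolding mat_act_def using Cc dc by (intro comm_scalar_prod[of _ k]) auto
    also have "\<dots> = Phi k ?g (mat_act C ?d) i j"
      by (rule Phi_eq_conormal[OF k1 mat_act_carrier[OF Cc dc], symmetric])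
    also have "\<dots> = Phi k (mat_act A ?g) (mat_act A (mat_act C ?d)) i j"
      by (rule Phi_mat_act[OF k1 A(1) gc mat_act_carrier[OF Cc dc], symmetric])
    also have "mat_act A (mat_act C ?d) = ?d"
      using assoc_mult_mat_vec[OF Ac Cc dc] dc by (auto simp: mat_act_def A(2))
    finally show ?thesis .
  qed
  with A(1) show ?thesis by blast
qed

end
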